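(* Let $n\ge 1$. All cube normalized symplectic capacities coincide on all monotone toric domains in $\mathbb{R}^{2n}$. That is, if $c$ and $c'$ are two cube normalized symplectic capacities (in dimension $2n$) and $X_\Omega\subset\mathbb{C}^n=\mathbb{R}^{2n}$ is a monotone toric domain, then $c(X_\Omega)=c'(X_\Omega)$.
   Context: Equip $\mathbb{C}^n=\mathbb{R}^{2n}$ with $\omega_0=\sum_{i=1}^n dx_i\wedge dy_i$; subsets of $\mathbb{C}^n$ carry the restriction of $\omega_0$, and $c(X)$ means $c(X,\omega_0)$. A symplectic capacity is a function assigning to each symplectic manifold $(X,\omega)$ of fixed dimension $2n$ (possibly in some restricted class, here containing the toric domains considered) a number $c(X,\omega)\in[0,\infty]$ such that: (1) if there is an embedding $\varphi:X_1\hookrightarrow X_2$ with $\varphi^*\omega_2=\omega_1$ (a symplectic embedding), then $c(X_1,\omega_1)\le c(X_2,\omega_2)$; (2) $c(X,r\omega)=r\,c(X,\omega)$ for $r>0$. A domain is the closure of a non-empty open set. Let $\mu:\mathbb{C}^n\to[0,\infty)^n$, $\mu(z_1,\dots,z_n)=(\pi|z_1|^2,\dots,\pi|z_n|^2)$. For a domain $\Omega\subset\mathbb{R}^n_{\ge0}$ the toric domain is $X_\Omega=\mu^{-1}(\Omega)$. Put $\partial_+\Omega=\{p\in\partial\Omega\mid p_i>0 \text{ for all } i\}$. A monotone toric domain is a compact toric domain $X_\Omega$ with smooth boundary such that for every $p\in\partial_+\Omega$ the outward pointing normal vector $\nu=(\nu_1,\dots,\nu_n)$ at $p$ satisfies $\nu_i\ge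 0$ for all $i$. For $a>0$: the cube is $P_n(a)=\mu^{-1}(\{x\in\mathbb{R}^n_{\ge0}\mid x_i\le a \text{ for all } i\})$, and the non-disjoint union of cylinders is $N_n(a)=\mu^{-1}(\{x\in\mathbb{R}^n_{\ge0}\mid x_i\le a\text{ for some } i\})$. A symplectic capacity $c$ is cube normalized if $c(P_n(1))=c(N_n(1))=1$. *)

theory Defs
  imports "HOL-Analysis.Analysis"
begin

section \<open>Smooth maps\<close>

text \<open>
  \<open>Ck_on k U f\<close> is the usual notion for open \<open>U\<close> only: in the recursion the Frechet derivative
  is evaluated on every fixed vector \<open>v\<close>, which in finite dimension amounts to asking that all
  partial derivatives of order at most \<open>k\<close> exist and are continuous.
\<close>

primrec Ck_on :: "nat \<Rightarrow> 'a::euclidean_space set \<Rightarrow> ('a \<Rightarrow> 'b::euclidean_space) \<Rightarrow> bool" where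
  "Ck_on 0 U f \<longleftrightarrow> continuous_on U f"
| "Ck_on (Suc k) U f \<longleftrightarrow>
     (\<forall>x\<in>U. f differentiable (at x)) \<and> (\<forall>v. Ck_on k U (\<lambda>x. frechet_derivative f (at x) v))"

definition smooth_on :: "'a::euclidean_space set \<Rightarrow> ('a \<Rightarrow> 'b::euclidean_space) \<Rightarrow> bool" where
  "smooth_on U f \<longleftrightarrow> open U \<and> (\<forall>k. Ck_on k U f)"

text \<open>
  Smoothness on an arbitrary subset means smoothness of some extension to an open neighbourhood.
  Functions are total here, so the extension is the function itself; the values away from \<open>X\<close>
  are irrelevant.
\<close>

definition smooth_near :: "'a::euclidean_space set \<Rightarrow> ('a \<Rightarrow> 'b::euclidean_space) \<Rightarrow> bool" where
  "smooth_near X f \<longleftrightarrow> (\<exists>U. X \<subseteq> U \<and> smooth_on U f)"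


section \<open>Domains with smooth boundary and outward normals\<close>

definition is_domain :: "'a::topological_space set \<Rightarrow> bool" where
  "is_domain S \<longleftrightarrow> (\<exists>U. open U \<and> U \<noteq> {} \<and> S = closure U)"

definition defining_function ::
    "'a::euclidean_space set \<Rightarrow> 'a \<Rightarrow> 'a set \<Rightarrow> ('a \<Rightarrow> real) \<Rightarrow> bool" where
  "defining_function S p U f \<longleftrightarrow>
     p \<in> U \<and> smooth_on U f \<and>
     (\<forall>x\<in>U. frechet_derivative f (at x) \<noteq> (\<lambda>_. 0)) \<and>
     S \<inter> U = {x \<in> U. f x \<le> 0}"

definition has_smooth_boundary :: "'a::euclidean_space set \<Rightarrow> bool" where
  "has_smooth_boundary S \<longleftrightarrow> (\<forall>p \<in> frontier S. \<exists>U f. defining_function S p U f)"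

text \<open>
  An outward normal at \<open>p\<close> is the gradient of a local defining function. No length is
  prescribed: positive multiples of defining functions are again defining functions, and any two
  gradients at a boundary point are positive multiples of each other.
\<close>

definition outward_normal :: "'a::euclidean_space set \<Rightarrow> 'a \<Rightarrow> 'a \<Rightarrow> bool" where
  "outward_normal S p \<nu> \<longleftrightarrow>
     p \<in> frontier S \<and>
     (\<exists>U f. defining_function S p U f \<and> (f has_derivative (\<lambda>h. \<nu> \<bullet> h)) (at p))"


section \<open>Symplectic manifolds and symplectic embeddings\<close>

type_synonym 'a two_form = "'a \<Rightarrow> 'a \<Rightarrow> 'a \<Rightarrow> real"

text \<open>
  Closedness is \<open>d\<omega> = 0\<close> evaluated on constant vector fields \<open>u\<close>, \<open>v\<close>, \<open>w\<close>, so that no Lie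
  bracket terms occur.
\<close>

definition symplectic_form_on :: "'a::euclidean_space set \<Rightarrow> 'a two_form \<Rightarrow> bool" where
  "symplectic_form_on X \<omega> \<longleftrightarrow>
     (\<forall>u v. smooth_near X (\<lambda>x. \<omega> x u v)) \<and>
     (\<forall>x\<in>X. bilinear (\<omega> x)) \<and>
     (\<forall>x\<in>X. \<forall>u. \<omega> x u u = 0) \<and>
     (\<forall>x\<in>X. \<forall>u. u \<noteq> 0 \<longrightarrow> (\<exists>v. \<omega> x u v \<noteq> 0)) \<and>
     (\<forall>x\<in>X. \<forall>u v w.
        frechet_derivative (\<lambda>y. \<omega> y v w) (at x) u
        - frechet_derivative (\<lambda>y. \<omega> y u w) (at x) v
        + frechet_derivative (\<lambda>y. \<omega> y u v) (at x) w = 0)"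

text \<open>
  Symplectic manifolds are realised as subsets of \<open>\<complex>\<^sup>n\<close>, possibly with boundary and corners,
  carrying an arbitrary symplectic form. The condition \<open>X \<subseteq> closure (interior X)\<close> holds for open
  sets and for closures of open sets; it makes derivatives at points of \<open>X\<close> independent of the
  chosen smooth extension.
\<close>

definition symplectic_mfd :: "(complex^'n) set \<times> (complex^'n) two_form \<Rightarrow> bool" where
  "symplectic_mfd M \<longleftrightarrow>
     fst M \<noteq> {} \<and> fst M \<subseteq> closure (interior (fst M)) \<and> symplectic_form_on (fst M) (snd M)"

definition smooth_embedding ::
    "('a::euclidean_space \<Rightarrow> 'b::euclidean_space) \<Rightarrow> 'a set \<Rightarrow> 'b set \<Rightarrow> bool" where
  "smooth_embedding \<phi> X Y \<longleftrightarrow>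
     \<phi> ` X \<subseteq> Y \<and> smooth_near X \<phi> \<and>
     (\<forall>x\<in>X. inj (frechet_derivative \<phi> (at x))) \<and>
     (\<exists>\<psi>. homeomorphism X (\<phi> ` X) \<phi> \<psi>)"

definition pullback ::
    "('a::euclidean_space \<Rightarrow> 'b::euclidean_space) \<Rightarrow> 'b two_form \<Rightarrow> 'a two_form" where
  "pullback \<phi> \<omega> x u v =
     \<omega> (\<phi> x) (frechet_derivative \<phi> (at x) u) (frechet_derivative \<phi> (at x) v)"

definition symplectic_embedding ::
    "('a::euclidean_space \<Rightarrow> 'a) \<Rightarrow> 'a set \<times> 'a two_form \<Rightarrow> 'a set \<times> 'a two_form \<Rightarrow> bool" where
  "symplectic_embedding \<phi> M N \<longleftrightarrow>
     smooth_embedding \<phi> (fst M) (fst N) \<and>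
     (\<forall>x\<in>fst M. pullback \<phi> (snd N) x = snd M x)"

definition scale_form :: "real \<Rightarrow> 'a two_form \<Rightarrow> 'a two_form" where
  "scale_form r \<omega> x u v = r * \<omega> x u v"

text \<open>The form \<open>\<Sum>\<^sub>i dx\<^sub>i \<and> dy\<^sub>i\<close> on \<open>\<complex>\<^sup>n\<close>, where \<open>z\<^sub>i = x\<^sub>i + \<i> y\<^sub>i\<close>.\<close>

definition \<omega>\<^sub>0 :: "(complex^'n) two_form" where
  "\<omega>\<^sub>0 z u v = (\<Sum>i\<in>UNIV. Re (u $ i) * Im (v $ i) - Im (u $ i) * Re (v $ i))"


section \<open>Toric domains\<close>

definition orthant :: "(real^'n) set" where
  "orthant = {x. \<forall>i. 0 \<le> x $ i}"

definition moment_map :: "complex^'n \<Rightarrow> real^'n" where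
  "moment_map z = (\<chi> i. pi * (norm (z $ i))\<^sup>2)"

definition toric :: "(real^'n) set \<Rightarrow> (complex^'n) set" where
  "toric \<Omega> = moment_map -` \<Omega>"

definition boundary_plus :: "(real^'n) set \<Rightarrow> (real^'n) set" where
  "boundary_plus \<Omega> = {p \<in> frontier \<Omega>. \<forall>i. 0 < p $ i}"

text \<open>
  \<open>is_domain\<close> uses open sets of \<open>\<real>\<^sup>n\<close>; relatively open subsets of the orthant have the same
  closures, since their parts in the open orthant are dense in them. At every point of
  \<open>boundary_plus \<Omega>\<close> an outward normal exists and is unique up to positive factors, because
  \<open>moment_map\<close> is a submersion over the open orthant.
\<close>

definition monotone_toric :: "(real^'n) set \<Rightarrow> bool" where
  "monotone_toric \<Omega> \<longleftrightarrow>
     is_domain \<Omega> \<and> \<Omega> \<subseteq> orthant \<and>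
     compact (toric \<Omega>) \<and> has_smooth_boundary (toric \<Omega>) \<and>
     (\<forall>p \<in> boundary_plus \<Omega>. \<forall>\<nu>. outward_normal \<Omega> p \<nu> \<longrightarrow> (\<forall>i. 0 \<le> \<nu> $ i))"

definition cube :: "real \<Rightarrow> (complex^'n) set" where
  "cube a = toric {x \<in> orthant. \<forall>i. x $ i \<le> a}"

definition cyl_union :: "real \<Rightarrow> (complex^'n) set" where
  "cyl_union a = toric {x \<in> orthant. \<exists>i. x $ i \<le> a}"


section \<open>Symplectic capacities\<close>

text \<open>
  A capacity comes with the class \<open>K\<close> of symplectic manifolds on which it is defined. The class is
  arbitrary, except that it must be closed under positive rescaling of the form, for conformality
  to make sense, and contain the toric domains under consideration. Values outside \<open>K\<close> are
  irrelevant.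
\<close>

definition admissible_class :: "((complex^'n) set \<times> (complex^'n) two_form) set \<Rightarrow> bool" where
  "admissible_class K \<longleftrightarrow>
     (\<forall>M\<in>K. symplectic_mfd M) \<and>
     (\<forall>X \<omega>. \<forall>r>0. (X, \<omega>) \<in> K \<longrightarrow> (X, scale_form r \<omega>) \<in> K) \<and>
     (\<forall>\<Omega>. monotone_toric \<Omega> \<longrightarrow> (toric \<Omega>, \<omega>\<^sub>0) \<in> K) \<and>
     (\<forall>a>0. (cube a, \<omega>\<^sub>0) \<in> K \<and> (cyl_union a, \<omega>\<^sub>0) \<in> K)"

definition symplectic_capacity ::
    "((complex^'n) set \<times> (complex^'n) two_form) set
     \<Rightarrow> ((complex^'n) set \<times> (complex^'n) two_form \<Rightarrow> ennreal) \<Rightarrow> bool" where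
  "symplectic_capacity K c \<longleftrightarrow>
     admissible_class K \<and>
     (\<forall>M\<in>K. \<forall>N\<in>K. (\<exists>\<phi>. symplectic_embedding \<phi> M N) \<longrightarrow> c M \<le> c N) \<and>
     (\<forall>X \<omega>. \<forall>r>0. (X, \<omega>) \<in> K \<longrightarrow> c (X, scale_form r \<omega>) = ennreal r * c (X, \<omega>))"

definition cube_normalized :: "((complex^'n) set \<times> (complex^'n) two_form \<Rightarrow> ennreal) \<Rightarrow> bool" where
  "cube_normalized c \<longleftrightarrow> c (cube 1, \<omega>\<^sub>0) = 1 \<and> c (cyl_union 1, \<omega>\<^sub>0) = 1"

end

theory Submission
  imports Defs
begin

text \<open>
  Write \<open>(t, \<dots>, t)\<close> for the diagonal points of the orthant and let \<open>a\<close> be the largest \<open>t\<close> whose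
  diagonal point lies in \<open>\<Omega>\<close>. The theorem holds because every cube normalized capacity of
  \<open>toric \<Omega>\<close> equals \<open>a\<close>: a monotone toric domain is squeezed by
  \<open>cube a \<subseteq> toric \<Omega> \<subseteq> cyl_union a\<close>, and both ends have capacity \<open>a\<close>, since the dilation
  by \<open>sqrt a\<close> carries \<open>cube 1\<close> and \<open>cyl_union 1\<close> to them and multiplies \<open>\<omega>\<^sub>0\<close> by \<open>a\<close>.

  Both inclusions follow from the fact that \<open>\<Omega>\<close> is downward closed in the orthant
  (\<open>monotone_toric_downward_closed\<close>): the first directly, and the second because a point of \<open>\<Omega>\<close>
  with all coordinates larger than \<open>a\<close> would put a later diagonal point into \<open>\<Omega>\<close>.

  For downward closedness, move from a point of \<open>\<Omega>\<close> in a direction \<open>-d\<close> with all \<open>d\<^sub>i > 0\<close>. At a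
  boundary point an outward normal \<open>\<nu>\<close> is nonzero with \<open>\<nu>\<^sub>i \<ge> 0\<close>, so \<open>\<nu> \<bullet> d > 0\<close> and the motion stays
  in \<open>\<Omega>\<close>; strict positivity of \<open>d\<close> is what compensates for normals with some zero entries. General
  pairs \<open>y \<le> x\<close> are limits of such strict ones.

  Smoothness of the boundary is given upstairs, for \<open>toric \<Omega>\<close>, while monotonicity speaks of normals
  of \<open>\<Omega>\<close> itself. A normal downstairs is produced by restricting a defining function along the
  smooth section \<open>x \<mapsto> (sqrt (x\<^sub>i / \<pi>))\<^sub>i\<close> of the moment map (\<open>outward_normal_exists\<close>). Its
  differential does not vanish, because the one upstairs already vanishes along torus orbits.
\<close>

section \<open>Calculus of \<open>C\<^sup>k\<close> maps\<close>

lemma frechet_derivative_eq: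
  "(f has_derivative D) (at x) \<Longrightarrow> frechet_derivative f (at x) = D"
  using frechet_derivative_at by metis

lemma Ck_on_cong:
  assumes "open U" "\<And>x. x \<in> U \<Longrightarrow> f x = g x" "Ck_on k U f"
  shows "Ck_on k U g"
  using assms(2,3)
proof (induction k arbitrary: f g)
  case 0
  then show ?case using continuous_on_cong[of U U f g] by simp
next
  case (Suc k)
  have D: "(g has_derivative frechet_derivative f (at x)) (at x)" if "x \<in> U" for x
  proof -
    have "(f has_derivative frechet_derivative f (at x)) (at x)"
      using Suc.prems(2) that frechet_derivative_works by auto
    then show ?thesis
      using has_derivative_transform_within_open[OF _ assms(1) that] Suc.prems(1) by metis
  qed
  have "Ck_on k U (\<lambda>x. frechet_derivative g (at x) v)" for v
  proof (rule Suc.IH)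
    show "Ck_on k U (\<lambda>x. frechet_derivative f (at x) v)" using Suc.prems(2) by simp
  qed (simp add: frechet_derivative_eq[OF D])
  then show ?case using D by (auto simp: differentiable_def)
qed

lemma Ck_on_SucI:
  assumes "open U" "\<And>x. x \<in> U \<Longrightarrow> (f has_derivative D x) (at x)"
    and "\<And>v. Ck_on k U (\<lambda>x. D x v)"
  shows "Ck_on (Suc k) U f"
proof -
  have "Ck_on k U (\<lambda>x. frechet_derivative f (at x) v)" for v
    by (rule Ck_on_cong[OF assms(1) _ assms(3)[of v]]) (simp add: frechet_derivative_eq[OF assms(2)])
  then show ?thesis using assms(2) by (auto simp: differentiable_def)
qed

lemma Ck_on_SucD:
  assumes "Ck_on (Suc k) U f"
  shows "Ck_on k U f"
  using assms
proof (induction k arbitrary: f)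
  case 0
  then show ?case
    by (auto intro!: continuous_at_imp_continuous_on differentiable_imp_continuous_within)
next
  case (Suc k)
  then show ?case by (metis Ck_on.simps(2))
qed

lemma Ck_on_has_derivative:
  assumes "Ck_on (Suc k) U f" "x \<in> U"
  shows "(f has_derivative frechet_derivative f (at x)) (at x)"
  using assms frechet_derivative_works by auto

lemma Ck_on_subset:
  "Ck_on k U f \<Longrightarrow> V \<subseteq> U \<Longrightarrow> Ck_on k V f"
  by (induction k arbitrary: f) (auto intro: continuous_on_subset)

lemma Ck_on_const: "open U \<Longrightarrow> Ck_on k U (\<lambda>_. c)"
proof (induction k arbitrary: c)
  case (Suc k)
  show ?case
    by (rule Ck_on_SucI[where D = "\<lambda>_ _. 0"]) (simp_all add: Suc.IH Suc.prems)
qed simp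

lemma Ck_on_bounded_linear:
  assumes "open U" "bounded_linear L"
  shows "Ck_on k U L"
proof (cases k)
  case 0
  then show ?thesis using assms(2) by (simp add: linear_continuous_on)
next
  case (Suc m)
  show ?thesis unfolding Suc
    by (rule Ck_on_SucI[where D = "\<lambda>_. L"])
      (intro assms(1) bounded_linear_imp_has_derivative[OF assms(2)] Ck_on_const[OF assms(1)])+
qed

lemma Ck_on_add:
  assumes "open U"
  shows "Ck_on k U f \<Longrightarrow> Ck_on k U g \<Longrightarrow> Ck_on k U (\<lambda>x. f x + g x)"
proof (induction k arbitrary: f g)
  case 0
  then show ?case by (simp add: continuous_on_add)
next
  case (Suc k)
  show ?case
  proof (rule Ck_on_SucI[OF assms])
    show "((\<lambda>x. f x + g x) has_derivative
        (\<lambda>v. frechet_derivative f (at x) v + frechet_derivative g (at x) v)) (at x)"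
      if "x \<in> U" for x
      using that by (intro has_derivative_add Suc.prems[THEN Ck_on_has_derivative])
    show "Ck_on k U (\<lambda>x. frechet_derivative f (at x) v + frechet_derivative g (at x) v)" for v
      using Suc.prems by (intro Suc.IH) auto
  qed
qed

lemma Ck_on_sum:
  assumes "open U" "\<And>i. i \<in> I \<Longrightarrow> Ck_on k U (f i)"
  shows "Ck_on k U (\<lambda>x. \<Sum>i\<in>I. f i x)"
  using assms(2)
  by (induction I rule: infinite_finite_induct)
    (auto intro: Ck_on_const Ck_on_add assms(1))

lemma Ck_on_scaleR:
  assumes "open U"
  shows "Ck_on k U f \<Longrightarrow> Ck_on k U g \<Longrightarrow> Ck_on k U (\<lambda>x. f x *\<^sub>R g x)"
proof (induction k arbitrary: f g)
  case 0
  then show ?case by (simp add: continuous_on_scaleR)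
next
  case (Suc k)
  show ?case
  proof (rule Ck_on_SucI[OF assms])
    show "((\<lambda>x. f x *\<^sub>R g x) has_derivative
        (\<lambda>v. f x *\<^sub>R frechet_derivative g (at x) v + frechet_derivative f (at x) v *\<^sub>R g x)) (at x)"
      if "x \<in> U" for x
      using that by (intro has_derivative_scaleR Suc.prems[THEN Ck_on_has_derivative])
    show "Ck_on k U (\<lambda>x. f x *\<^sub>R frechet_derivative g (at x) v
        + frechet_derivative f (at x) v *\<^sub>R g x)" for v
      using Suc.prems Ck_on_SucD[OF Suc.prems(1)] Ck_on_SucD[OF Suc.prems(2)]
      by (intro Ck_on_add Suc.IH assms) auto
  qed
qed

lemma Ck_on_inner_const:
  assumes "open U"
  shows "Ck_on k U f \<Longrightarrow> Ck_on k U (\<lambda>x. f x \<bullet> b)"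
proof (induction k arbitrary: f)
  case 0
  then show ?case by (simp add: continuous_on_inner continuous_on_const)
next
  case (Suc k)
  show ?case
  proof (rule Ck_on_SucI[OF assms])
    show "((\<lambda>x. f x \<bullet> b) has_derivative (\<lambda>v. frechet_derivative f (at x) v \<bullet> b)) (at x)"
      if "x \<in> U" for x
      using that by (intro has_derivative_inner_left Suc.prems[THEN Ck_on_has_derivative])
    show "Ck_on k U (\<lambda>x. frechet_derivative f (at x) v \<bullet> b)" for v
      using Suc.prems by (intro Suc.IH) auto
  qed
qed

text \<open>
  Expanding \<open>Ds(x) v\<close> in the standard basis turns the chain rule into a sum of products of a
  component of \<open>Ds\<close> with \<open>Df(s x) b\<close> for fixed \<open>b\<close>. The latter is again a composition of a map with
  \<open>s\<close>, of one order of differentiability less, which is what makes the induction work.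
\<close>

lemma Ck_on_compose:
  fixes s :: "'a::euclidean_space \<Rightarrow> 'b::euclidean_space"
    and f :: "'b \<Rightarrow> 'c::euclidean_space"
  assumes U: "open U" and sub: "s ` U \<subseteq> V"
  shows "Ck_on k U s \<Longrightarrow> Ck_on k V f \<Longrightarrow> Ck_on k U (\<lambda>x. f (s x))"
proof (induction k arbitrary: f)
  case 0
  then show ?case using continuous_on_compose2[of V f U s] sub by simp
next
  case (Suc k)
  show ?case
  proof (rule Ck_on_SucI[OF U])
    fix x assume x: "x \<in> U"
    let ?S = "frechet_derivative s (at x)" and ?F = "frechet_derivative f (at (s x))"
    have F: "(f has_derivative ?F) (at (s x))"
      using Ck_on_has_derivative[OF Suc.prems(2)] sub x by blast
    have expand: "?F w = (\<Sum>b\<in>Basis. (w \<bullet> b) *\<^sub>R ?F b)" for w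
    proof -
      have "linear ?F" using F has_derivative_linear by blast
      then have "?F (\<Sum>b\<in>Basis. (w \<bullet> b) *\<^sub>R b) = (\<Sum>b\<in>Basis. (w \<bullet> b) *\<^sub>R ?F b)"
        by (simp add: linear_sum linear_scale)
      then show ?thesis by (simp add: euclidean_representation)
    qed
    have "((\<lambda>x. f (s x)) has_derivative (\<lambda>v. ?F (?S v))) (at x)"
      using has_derivative_compose[OF Ck_on_has_derivative[OF Suc.prems(1) x] F] .
    then show "((\<lambda>x. f (s x)) has_derivative (\<lambda>v. \<Sum>b\<in>Basis.
        (frechet_derivative s (at x) v \<bullet> b) *\<^sub>R frechet_derivative f (at (s x)) b)) (at x)"
      by (subst (asm) expand)
  next
    fix v
    show "Ck_on k U (\<lambda>x. \<Sum>b\<in>Basis.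
        (frechet_derivative s (at x) v \<bullet> b) *\<^sub>R frechet_derivative f (at (s x)) b)"
      using Suc.prems Ck_on_SucD[OF Suc.prems(1)]
      by (intro Ck_on_sum U Ck_on_scaleR Ck_on_inner_const Suc.IH) auto
  qed
qed

lemma Ck_on_powr:
  fixes a :: real
  shows "Ck_on k {0<..} (\<lambda>t. t powr a)"
proof (induction k arbitrary: a)
  case 0
  show ?case by (auto intro!: continuous_intros)
next
  case (Suc k)
  show ?case
  proof (rule Ck_on_SucI)
    show "((\<lambda>t. t powr a) has_derivative (\<lambda>v. t powr (a - 1) *\<^sub>R (a * v))) (at t)"
      if "t \<in> {0<..}" for t
      using has_real_derivative_powr[of t a] that unfolding has_field_derivative_def
      by (auto elim!: has_derivative_eq_rhs)
    show "Ck_on k {0<..} (\<lambda>t. t powr (a - 1) *\<^sub>R (a * v))" for v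
      by (intro Ck_on_scaleR Ck_on_const Suc.IH) auto
  qed auto
qed


section \<open>The moment map and its positive section\<close>

text \<open>
  The square root is written as a power because the functions \<open>t \<mapsto> t\<^sup>a\<close> form a family closed under
  differentiation up to scalars, so that one induction shows all of them to be smooth.
\<close>

definition moment_section :: "real^'n \<Rightarrow> complex^'n" where
  "moment_section x = (\<Sum>i\<in>UNIV. ((x $ i / pi) powr (1/2)) *\<^sub>R axis i 1)"

lemma moment_section_nth: "moment_section x $ i = complex_of_real ((x $ i / pi) powr (1/2))"
proof -
  have "moment_section x $ i
      = (\<Sum>j\<in>UNIV. if j = i then complex_of_real ((x $ i / pi) powr (1/2)) else 0)"
    unfolding moment_section_def sum_component
    by (rule sum.cong) (auto simp: axis_def of_real_def)
  then show ?thesis by simp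
qed

lemma moment_map_moment_section: "x \<in> orthant \<Longrightarrow> moment_map (moment_section x) = x"
  by (auto simp: moment_map_def moment_section_nth vec_eq_iff orthant_def powr_half_sqrt)

lemma open_positive_orthant: "open {x::real^'n. \<forall>i. 0 < x $ i}"
proof -
  have "{x::real^'n. \<forall>i. 0 < x $ i} = (\<Inter>i\<in>UNIV. {x. 0 < x $ i})" by auto
  also have "open \<dots>"
    by (intro open_INT ballI open_Collect_less continuous_intros) auto
  finally show ?thesis .
qed

lemma Ck_on_moment_section: "Ck_on k {x::real^'n. \<forall>i. 0 < x $ i} moment_section"
proof -
  let ?P = "{x::real^'n. \<forall>i. 0 < x $ i}"
  have "bounded_linear (\<lambda>x::real^'n. x $ i / pi)" for i
    by (intro bounded_linear_divide[THEN bounded_linear_compose] bounded_linear_vec_nth)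
  then have "Ck_on k ?P (\<lambda>x. x $ i / pi)" for i
    by (rule Ck_on_bounded_linear[OF open_positive_orthant])
  then have "Ck_on k ?P (\<lambda>x. (x $ i / pi) powr (1/2))" for i
    using Ck_on_compose[OF open_positive_orthant, where s = "\<lambda>x. x $ i / pi" and V = "{0<..}"
        and f = "\<lambda>t. t powr (1/2)"] Ck_on_powr by fastforce
  then show ?thesis
    unfolding moment_section_def[abs_def]
    by (intro Ck_on_sum Ck_on_scaleR Ck_on_const open_positive_orthant)
qed

lemma has_derivative_moment_section:
  fixes x :: "real^'n"
  assumes "\<forall>i. 0 < x $ i"
  obtains S where "(moment_section has_derivative S) (at x)"
    and "\<And>i. \<exists>c>0. S (axis i 1) = c *\<^sub>R axis i 1"
proof
  let ?c = "\<lambda>i. 1/2 * (x $ i / pi) powr (1/2 - 1) / pi"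
  have D: "((\<lambda>x::real^'n. (x $ i / pi) powr (1/2)) has_derivative (\<lambda>v. ?c i * v $ i)) (at x)" for i
  proof -
    have "0 < x $ i / pi" using assms by simp
    from has_real_derivative_powr[OF this, of "1/2"]
    have "((\<lambda>t. t powr (1/2)) has_derivative (\<lambda>u. 1/2 * (x $ i / pi) powr (1/2 - 1) * u))
        (at (x $ i / pi))"
      unfolding has_field_derivative_def by (rule has_derivative_eq_rhs) auto
    moreover have "((\<lambda>x::real^'n. x $ i / pi) has_derivative (\<lambda>v. v $ i / pi)) (at x)"
      by (intro bounded_linear_imp_has_derivative
          bounded_linear_divide[THEN bounded_linear_compose] bounded_linear_vec_nth)
    ultimately show ?thesis
      using has_derivative_compose[where f = "\<lambda>x::real^'n. x $ i / pi"] by fastforce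
  qed
  show "(moment_section has_derivative (\<lambda>v. \<Sum>i\<in>UNIV. (?c i * v $ i) *\<^sub>R axis i 1)) (at x)"
    unfolding moment_section_def[abs_def]
    by (intro has_derivative_sum has_derivative_scaleR_left D)
  show "\<exists>c>0. (\<Sum>j\<in>UNIV. (?c j * axis i 1 $ j) *\<^sub>R axis j 1) = c *\<^sub>R (axis i 1 :: complex^'n)" for i
  proof (intro exI conjI)
    show "0 < ?c i" using assms[rule_format, of i] by simp
    have "(\<Sum>j\<in>UNIV. (?c j * axis i 1 $ j) *\<^sub>R axis j 1)
        = (\<Sum>j\<in>UNIV. if j = i then ?c i *\<^sub>R (axis i 1 :: complex^'n) else 0)"
      by (rule sum.cong) (auto simp: axis_def)
    then show "(\<Sum>j\<in>UNIV. (?c j * axis i 1 $ j) *\<^sub>R axis j 1) = ?c i *\<^sub>R (axis i 1 :: complex^'n)"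
      by simp
  qed
qed

lemma continuous_on_moment_map: "continuous_on A moment_map"
  unfolding moment_map_def by (intro continuous_intros)

lemma moment_map_image_toric: "\<Omega> \<subseteq> orthant \<Longrightarrow> moment_map ` toric \<Omega> = \<Omega>"
  by (fastforce simp: toric_def image_iff intro: moment_map_moment_section[symmetric])

lemma moment_section_in_toric_iff:
  "x \<in> orthant \<Longrightarrow> moment_section x \<in> toric \<Omega> \<longleftrightarrow> x \<in> \<Omega>"
  by (simp add: toric_def moment_map_moment_section)

text \<open>The curve \<open>\<theta> \<mapsto> z + (e\<^sup>i\<^sup>\<theta> - 1) z\<^sub>i\<close> in the \<open>i\<close>-th coordinate is an orbit of the torus action.\<close>

lemma moment_map_rotate:
  "moment_map (z + axis i (z $ i * (cis \<theta> - 1))) = moment_map z"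
proof -
  have "norm ((z + axis i (z $ i * (cis \<theta> - 1))) $ j) = norm (z $ j)" for j
  proof (cases "j = i")
    case True
    have "z $ i + z $ i * (cis \<theta> - 1) = z $ i * cis \<theta>" by (simp add: algebra_simps)
    then show ?thesis using True by (simp add: axis_def norm_mult)
  qed (simp add: axis_def)
  then show ?thesis by (simp add: moment_map_def)
qed


section \<open>Outward normals of the moment image\<close>

text \<open>
  Along the orbit through \<open>z\<close> the function \<open>f\<close> is at most \<open>0\<close>, so \<open>z\<close> is a local maximum there.
\<close>

lemma defining_function_derivative_rotation:
  assumes f: "defining_function (toric \<Omega>) z U f" and z: "f z = 0"
    and D: "(f has_derivative F) (at z)"
  shows "F (axis i (z $ i * \<i>)) = 0"
proof -
  define \<gamma> where "\<gamma> \<theta> = z + axis i (z $ i * (cis \<theta> - 1))" for \<theta>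
  have U: "open U" "z \<in> U" and SU: "toric \<Omega> \<inter> U = {x \<in> U. f x \<le> 0}"
    using f by (auto simp: defining_function_def smooth_on_def)
  have \<gamma>0: "\<gamma> 0 = z" by (simp add: \<gamma>_def axis_def vec_eq_iff)
  have "((\<lambda>\<theta>. z $ i * (cis \<theta> - 1)) has_derivative (\<lambda>t. t *\<^sub>R (z $ i * \<i>))) (at 0)"
    by (auto simp: scaleR_conv_of_real intro!: derivative_eq_intros)
  moreover have "bounded_linear (axis i :: complex \<Rightarrow> complex^'a)"
    by (intro linear_linear[THEN iffD2] linearI) (auto simp: axis_def vec_eq_iff)
  ultimately have "((\<lambda>\<theta>. axis i (z $ i * (cis \<theta> - 1))) has_derivative
      (\<lambda>t. axis i (t *\<^sub>R (z $ i * \<i>)))) (at 0)"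
    using bounded_linear.has_derivative by blast
  then have D\<gamma>: "(\<gamma> has_derivative (\<lambda>t. axis i (t *\<^sub>R (z $ i * \<i>)))) (at 0)"
    unfolding \<gamma>_def[abs_def] by (auto intro!: derivative_eq_intros)
  have "((\<lambda>\<theta>. f (\<gamma> \<theta>)) has_derivative (\<lambda>t. F (axis i (t *\<^sub>R (z $ i * \<i>))))) (at 0)"
    using has_derivative_compose[OF D\<gamma>, of f F] D by (simp add: \<gamma>0)
  moreover have "eventually (\<lambda>\<theta>. f (\<gamma> \<theta>) \<le> f (\<gamma> 0)) (at 0)"
  proof -
    have "(\<gamma> \<longlongrightarrow> z) (at 0)"
      using has_derivative_continuous[OF D\<gamma>] \<gamma>0 by (simp add: continuous_within)
    then have "eventually (\<lambda>\<theta>. \<gamma> \<theta> \<in> U) (at 0)" using U by (rule topological_tendstoD)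
    moreover have "z \<in> toric \<Omega>" using SU U(2) z by force
    then have "\<gamma> \<theta> \<in> toric \<Omega>" for \<theta> by (simp add: \<gamma>_def toric_def moment_map_rotate)
    then have "f (\<gamma> \<theta>) \<le> f (\<gamma> 0)" if "\<gamma> \<theta> \<in> U" for \<theta>
      using SU that unfolding \<gamma>0 z by blast
    ultimately show ?thesis by (rule eventually_mono)
  qed
  ultimately have "(\<lambda>t::real. F (axis i (t *\<^sub>R (z $ i * \<i>)))) = (\<lambda>_. 0)"
    by (rule has_derivative_local_max)
  then show ?thesis by (metis scaleR_one)
qed

text \<open>Where \<open>f < 0\<close>, a whole neighbourhood lies in \<open>S\<close>.\<close>

lemma defining_function_zero_on_frontier:
  assumes f: "defining_function S p U f" and p: "p \<in> frontier S" "p \<in> S"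
  shows "f p = 0"
proof (rule ccontr)
  assume neq: "f p \<noteq> 0"
  have U: "open U" "p \<in> U" and SU: "S \<inter> U = {x \<in> U. f x \<le> 0}" and C0: "Ck_on 0 U f"
    using f by (auto simp: defining_function_def smooth_on_def simp del: Ck_on.simps)
  have "open {x \<in> U. f x < 0}"
    using continuous_open_preimage[of U f "{..<0}"] C0 U(1) by (simp add: vimage_def Int_def)
  moreover have "p \<in> {x \<in> U. f x < 0}" using neq SU U p by force
  moreover have "{x \<in> U. f x < 0} \<subseteq> S" using SU by force
  ultimately have "p \<in> interior S" by (meson interiorI)
  then show False using p by (simp add: frontier_def)
qed

text \<open>
  The differential of \<open>f\<close> upstairs kills the angular directions, so if it also killed the radial
  ones, which span the image of the differential of the section, it would vanish.
\<close>

lemma outward_normal_exists: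
  fixes \<Omega> :: "(real^'n) set"
  assumes smooth: "has_smooth_boundary (toric \<Omega>)" and cl: "closed \<Omega>"
    and p: "p \<in> boundary_plus \<Omega>"
  obtains \<nu> where "outward_normal \<Omega> p \<nu>" "\<nu> \<noteq> 0"
proof -
  define P where "P = {x::real^'n. \<forall>i. 0 < x $ i}"
  have oP: "open P" unfolding P_def by (rule open_positive_orthant)
  have P_orth: "x \<in> orthant" if "x \<in> P" for x using that by (auto simp: P_def orthant_def less_imp_le)
  have pP: "p \<in> P" and pfr: "p \<in> frontier \<Omega>" using p by (auto simp: boundary_plus_def P_def)
  have p\<Omega>: "p \<in> \<Omega>" using pfr cl frontier_subset_closed by blast
  let ?s = "moment_section :: real^'n \<Rightarrow> complex^'n"
  have sC: "Ck_on k P ?s" for k unfolding P_def by (rule Ck_on_moment_section)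
  have scont: "continuous_on P ?s" using sC[of 0] by simp
  have open_pre: "open {x \<in> P. ?s x \<in> V}" if "open V" for V
    using continuous_open_preimage[OF scont oP that] by (simp add: vimage_def Int_def)
  define z where "z = ?s p"
  have z\<Omega>: "z \<in> toric \<Omega>" using p\<Omega> pP P_orth by (simp add: z_def moment_section_in_toric_iff)
  have zfr: "z \<in> frontier (toric \<Omega>)"
  proof -
    have "z \<notin> interior (toric \<Omega>)"
    proof
      assume "z \<in> interior (toric \<Omega>)"
      then have "p \<in> {x \<in> P. ?s x \<in> interior (toric \<Omega>)}" using pP by (simp add: z_def)
      moreover have "{x \<in> P. ?s x \<in> interior (toric \<Omega>)} \<subseteq> \<Omega>"
        using interior_subset moment_section_in_toric_iff P_orth by blast
      ultimately have "p \<in> interior \<Omega>" using open_pre[of "interior (toric \<Omega>)"] interiorI by blast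
      then show False using pfr by (simp add: frontier_def)
    qed
    then show ?thesis using z\<Omega> closure_subset by (auto simp: frontier_def)
  qed
  then obtain U f where f: "defining_function (toric \<Omega>) z U f"
    using smooth by (auto simp: has_smooth_boundary_def)
  have oU: "open U" and zU: "z \<in> U" and fC: "\<And>k. Ck_on k U f"
    and SU: "toric \<Omega> \<inter> U = {x \<in> U. f x \<le> 0}"
    and reg: "frechet_derivative f (at z) \<noteq> (\<lambda>_. 0)"
    using f by (auto simp: defining_function_def smooth_on_def)
  have f0: "f z = 0" using defining_function_zero_on_frontier[OF f zfr z\<Omega>] .
  define F where "F = frechet_derivative f (at z)"
  have FD: "(f has_derivative F) (at z)"
    unfolding F_def using Ck_on_has_derivative[OF fC zU] .
  have linF: "linear F" using FD has_derivative_linear by blast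
  obtain S where SD: "(?s has_derivative S) (at p)"
    and S: "\<And>i. \<exists>c>0. S (axis i 1) = c *\<^sub>R axis i 1"
    using has_derivative_moment_section pP unfolding P_def by blast
  define W where "W = {x \<in> P. ?s x \<in> U}"
  have oW: "open W" unfolding W_def using open_pre[OF oU] .
  have pW: "p \<in> W" using pP zU by (simp add: W_def z_def)
  define g where "g x = f (?s x)" for x
  have gC: "Ck_on k W g" for k
    unfolding g_def[abs_def]
    by (rule Ck_on_compose[OF oW _ _ fC]) (use Ck_on_subset[OF sC, of W] in \<open>auto simp: W_def\<close>)
  have gD: "(g has_derivative (\<lambda>v. F (S v))) (at p)"
    unfolding g_def[abs_def] using has_derivative_compose[OF SD, of f F] FD by (simp add: z_def)
  have "\<exists>v. F (S v) \<noteq> 0"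
  proof (rule ccontr)
    assume "\<not> ?thesis"
    then have FS: "F (S v) = 0" for v by simp
    have re: "F (axis i 1) = 0" for i
      using S[of i] FS[of "axis i 1"] linear_scale[OF linF] by force
    \<comment> \<open>The coordinates of the section are positive reals, so the orbit direction is a multiple of \<open>\<i>\<close>.\<close>
    have im: "F (axis i \<i>) = 0" for i
    proof -
      define r where "r = (p $ i / pi) powr (1/2)"
      have r: "r \<noteq> 0" "z $ i = complex_of_real r"
        using pP by (auto simp: r_def z_def moment_section_nth P_def dest: spec[of _ i])
      have "axis i (z $ i * \<i>) = r *\<^sub>R (axis i \<i> :: complex^'n)"
        by (auto simp: r axis_def vec_eq_iff complex_eq_iff)
      then show ?thesis
        using defining_function_derivative_rotation[OF f f0 FD, of i] r linear_scale[OF linF]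
        by simp
    qed
    have "F b = 0" if "b \<in> Basis" for b
      using that re im by (auto simp: Basis_vec_def Basis_complex_def)
    then have "F = (\<lambda>_. 0)"
      using linear_eq_stdbasis[OF linF linear_zero] by auto
    then show False using reg F_def by simp
  qed
  then obtain v where v: "F (S v) \<noteq> 0" by blast
  \<comment> \<open>A defining function must be regular on its whole neighbourhood, so shrink \<open>W\<close>.\<close>
  define W' where "W' = {x \<in> W. frechet_derivative g (at x) v \<noteq> 0}"
  have "continuous_on W (\<lambda>x. frechet_derivative g (at x) v)" using gC[of "Suc 0"] by simp
  from continuous_open_preimage[OF this oW, of "- {0}"] have oW': "open W'"
    by (simp add: W'_def vimage_def Int_def open_Compl)
  have W'W: "W' \<subseteq> W" by (auto simp: W'_def)
  have "defining_function \<Omega> p W' g"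
    unfolding defining_function_def smooth_on_def
  proof (intro conjI allI ballI)
    show "p \<in> W'" using pW v frechet_derivative_eq[OF gD] by (simp add: W'_def)
    show "Ck_on k W' g" for k using gC W'W Ck_on_subset by blast
    show "frechet_derivative g (at x) \<noteq> (\<lambda>_. 0)" if "x \<in> W'" for x
      using that by (auto simp: W'_def)
    have "x \<in> \<Omega> \<longleftrightarrow> g x \<le> 0" if "x \<in> W" for x
    proof -
      have "x \<in> P" "?s x \<in> U" using that by (auto simp: W_def)
      then show ?thesis
        using moment_section_in_toric_iff[OF P_orth, of x \<Omega>] SU by (auto simp: g_def)
    qed
    then show "\<Omega> \<inter> W' = {x \<in> W'. g x \<le> 0}" using W'W by blast
  qed (rule oW')
  moreover
  define \<nu> where "\<nu> = (\<Sum>b\<in>Basis. F (S b) *\<^sub>R b)"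
  have linFS: "linear (\<lambda>v. F (S v))" using gD has_derivative_linear by blast
  have \<nu>: "F (S h) = \<nu> \<bullet> h" for h
  proof -
    have "F (S h) = F (S (\<Sum>b\<in>Basis. (h \<bullet> b) *\<^sub>R b))"
      by (simp only: euclidean_representation)
    also have "\<dots> = (\<Sum>b\<in>Basis. F (S ((h \<bullet> b) *\<^sub>R b)))"
      by (rule linear_sum[OF linFS])
    also have "\<dots> = (\<Sum>b\<in>Basis. (F (S b) *\<^sub>R b) \<bullet> h)"
    proof (rule sum.cong)
      fix b :: "real^'n"
      show "F (S ((h \<bullet> b) *\<^sub>R b)) = (F (S b) *\<^sub>R b) \<bullet> h"
        using linear_scale[OF linFS, of "h \<bullet> b" b]
        by (simp only: inner_scaleR_left inner_commute[of b h] real_scaleR_def mult.commute[of "F (S b)"])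
    qed simp
    finally show ?thesis by (simp only: \<nu>_def inner_sum_left)
  qed
  ultimately have "outward_normal \<Omega> p \<nu>"
    unfolding outward_normal_def using pfr gD by auto
  moreover have "\<nu> \<noteq> 0" using v \<nu> by auto
  ultimately show thesis using that by blast
qed


section \<open>Monotone toric domains are downward closed\<close>

text \<open>
  At a boundary point, a local defining function has derivative \<open>-(\<nu> \<bullet> d) < 0\<close> at \<open>t = 0\<close> along
  \<open>p - t d\<close>, so it is negative for small \<open>t > 0\<close>.
\<close>

lemma monotone_toric_local_descent:
  fixes \<Omega> :: "(real^'n) set"
  assumes m: "monotone_toric \<Omega>" and p: "p \<in> \<Omega>" "\<forall>i. 0 < p $ i" and d: "\<forall>i. 0 < d $ i"
  shows "eventually (\<lambda>t. p - t *\<^sub>R d \<in> \<Omega>) (at_right 0)"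
proof -
  have lim: "((\<lambda>t::real. p - t *\<^sub>R d) \<longlongrightarrow> p) (at_right 0)"
    by (auto intro!: tendsto_eq_intros)
  show ?thesis
  proof (cases "p \<in> interior \<Omega>")
    case True
    then have "eventually (\<lambda>t. p - t *\<^sub>R d \<in> interior \<Omega>) (at_right 0)"
      using topological_tendstoD[OF lim] by simp
    then show ?thesis using interior_subset by (auto elim!: eventually_mono)
  next
    case False
    then have bp: "p \<in> boundary_plus \<Omega>"
      using p closure_subset by (auto simp: boundary_plus_def frontier_def)
    have "closed \<Omega>" "has_smooth_boundary (toric \<Omega>)"
      using m by (auto simp: monotone_toric_def is_domain_def)
    then obtain \<nu> where \<nu>: "outward_normal \<Omega> p \<nu>" "\<nu> \<noteq> 0"
      using outward_normal_exists bp by blast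
    then have nonneg: "\<forall>i. 0 \<le> \<nu> $ i" using m bp by (auto simp: monotone_toric_def)
    obtain i where i: "\<nu> $ i \<noteq> 0" using \<nu>(2) by (auto simp: vec_eq_iff)
    have "0 < (\<Sum>j\<in>UNIV. \<nu> $ j * d $ j)"
      using nonneg d i by (intro sum_pos2[of _ i]) (auto simp: less_le mult_nonneg_nonneg)
    then have pos: "0 < \<nu> \<bullet> d" by (simp add: inner_vec_def)
    obtain U f where f: "defining_function \<Omega> p U f" and fD: "(f has_derivative (\<lambda>h. \<nu> \<bullet> h)) (at p)"
      using \<nu>(1) by (auto simp: outward_normal_def)
    have U: "open U" "p \<in> U" and SU: "\<Omega> \<inter> U = {x \<in> U. f x \<le> 0}"
      using f by (auto simp: defining_function_def smooth_on_def)
    have inU: "eventually (\<lambda>t. p - t *\<^sub>R d \<in> U) (at_right 0)"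
      using topological_tendstoD[OF lim U] .
    have "((\<lambda>t::real. p - t *\<^sub>R d) has_derivative (\<lambda>t. - (t *\<^sub>R d))) (at 0)"
      by (auto intro!: derivative_eq_intros)
    then have "((\<lambda>t. f (p - t *\<^sub>R d)) has_derivative (\<lambda>t. \<nu> \<bullet> (- (t *\<^sub>R d)))) (at 0)"
      using has_derivative_compose[of "\<lambda>t. p - t *\<^sub>R d" _ 0 UNIV f] fD by fastforce
    then have "((\<lambda>t. f (p - t *\<^sub>R d)) has_real_derivative (- (\<nu> \<bullet> d))) (at 0)"
      unfolding has_field_derivative_def by (rule has_derivative_eq_rhs) auto
    then obtain e where e: "0 < e" "\<And>t. 0 < t \<Longrightarrow> t < e \<Longrightarrow> f (p - t *\<^sub>R d) < f p"
      using DERIV_neg_dec_right[of "\<lambda>t. f (p - t *\<^sub>R d)" "- (\<nu> \<bullet> d)" 0] pos by auto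
    have "f p \<le> 0" using SU U p by auto
    then have "eventually (\<lambda>t. f (p - t *\<^sub>R d) \<le> 0) (at_right 0)"
      using e by (auto simp: eventually_at_right_field intro!: exI[of _ e]) (meson less_le_trans less_imp_le)
    with inU show ?thesis by eventually_elim (use SU in auto)
  qed
qed

lemma monotone_toric_strict_descent:
  fixes \<Omega> :: "(real^'n) set"
  assumes m: "monotone_toric \<Omega>" and x: "x \<in> \<Omega>" and y: "\<forall>i. 0 < y $ i" "\<forall>i. y $ i < x $ i"
  shows "y \<in> \<Omega>"
proof (rule ccontr)
  assume ny: "y \<notin> \<Omega>"
  have cl: "closed \<Omega>" using m by (auto simp: monotone_toric_def is_domain_def)
  define d where "d = x - y"
  have d: "\<forall>i. 0 < d $ i" using y by (simp add: d_def)
  define B where "B = {t \<in> {0..1}. x - t *\<^sub>R d \<in> \<Omega>}"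
  have "compact B"
  proof -
    have "closed ((\<lambda>t. x - t *\<^sub>R d) -` \<Omega>)" by (intro closed_vimage cl continuous_intros)
    moreover have "B = {0..1} \<inter> (\<lambda>t. x - t *\<^sub>R d) -` \<Omega>" by (auto simp: B_def)
    ultimately show ?thesis by (simp add: compact_Int_closed)
  qed
  moreover have "0 \<in> B" using x by (simp add: B_def)
  \<comment> \<open>The last point of the segment from \<open>x\<close> to \<open>y\<close> that lies in \<open>\<Omega>\<close>.\<close>
  ultimately obtain t where t: "t \<in> B" "\<forall>u\<in>B. u \<le> t"
    using compact_attains_sup[of B] by blast
  define p where "p = x - t *\<^sub>R d"
  have "t \<noteq> 1" using t(1) ny by (auto simp: B_def d_def)
  then have t01: "0 \<le> t" "t < 1" using t(1) by (auto simp: B_def)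
  have "0 < p $ i" for i
  proof -
    have "p $ i = y $ i + (1 - t) * d $ i" by (simp add: p_def d_def algebra_simps)
    then show ?thesis using y(1) d t01 by (simp add: add_pos_pos)
  qed
  moreover have "p \<in> \<Omega>" using t(1) by (simp add: B_def p_def)
  ultimately have "eventually (\<lambda>u. p - u *\<^sub>R d \<in> \<Omega>) (at_right 0)"
    using monotone_toric_local_descent[OF m] d by blast
  moreover have "eventually (\<lambda>u. u \<in> {0<..<1 - t}) (at_right 0)"
    using t01 by (intro eventually_at_right_real) auto
  ultimately have "eventually (\<lambda>u. p - u *\<^sub>R d \<in> \<Omega> \<and> u \<in> {0<..<1 - t}) (at_right 0)"
    by (rule eventually_conj)
  then obtain u where u: "p - u *\<^sub>R d \<in> \<Omega>" "0 < u" "u < 1 - t"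
    using eventually_happens'[of "at_right (0::real)"] by auto
  then have "t + u \<in> B" using t01 by (auto simp: B_def p_def algebra_simps)
  then show False using t(2) u(2) by force
qed

text \<open>Otherwise a small step in direction \<open>-e\<^sub>i\<close> would stay in \<open>V\<close> but leave the orthant.\<close>

lemma open_subset_orthant_positive:
  fixes V :: "(real^'n) set"
  assumes "open V" "V \<subseteq> orthant" "v \<in> V"
  shows "0 < v $ i"
proof -
  obtain e where e: "0 < e" "cball v e \<subseteq> V" using assms open_contains_cball by blast
  have "v - e *\<^sub>R axis i 1 \<in> cball v e" using e(1) by (simp add: dist_norm)
  then have "v - e *\<^sub>R axis i 1 \<in> orthant" using e(2) assms(2) by blast
  then have "0 \<le> (v - e *\<^sub>R axis i 1) $ i" unfolding orthant_def by blast
  then show ?thesis using e(1) by (simp add: axis_def)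
qed

text \<open>
  Points of \<open>\<Omega>\<close> are limits of points \<open>x\<^sub>k\<close> of the open set whose closure \<open>\<Omega>\<close> is, and those have
  positive coordinates. The points \<open>min y\<^sub>i x\<^sub>k\<^sub>,\<^sub>i\<close>, moved by a fraction \<open>1/(k+2)\<close> towards \<open>x\<^sub>k / 2\<close>,
  are positive, strictly below \<open>x\<^sub>k\<close>, and converge to \<open>y\<close>.
\<close>

lemma monotone_toric_downward_closed:
  fixes \<Omega> :: "(real^'n) set"
  assumes m: "monotone_toric \<Omega>" and x: "x \<in> \<Omega>" and y: "y \<in> orthant" "\<forall>i. y $ i \<le> x $ i"
  shows "y \<in> \<Omega>"
proof -
  obtain V where V: "open V" "\<Omega> = closure V" using m by (auto simp: monotone_toric_def is_domain_def)
  obtain X where X: "\<And>k. X k \<in> V" "X \<longlonglongrightarrow> x"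
    using x V(2) closure_sequential by blast
  have X\<Omega>: "X k \<in> \<Omega>" for k using X(1) V(2) closure_subset by blast
  have "V \<subseteq> orthant" using V(2) closure_subset m by (auto simp: monotone_toric_def)
  then have Xpos: "0 < X k $ i" for k i using open_subset_orthant_positive V(1) X(1) by blast
  define \<epsilon> where "\<epsilon> k = 1 / real (k + 2)" for k
  have \<epsilon>: "0 < \<epsilon> k" "\<epsilon> k < 1" for k by (auto simp: \<epsilon>_def)
  have \<epsilon>0: "\<epsilon> \<longlonglongrightarrow> 0"
    unfolding \<epsilon>_def[abs_def] using LIMSEQ_ignore_initial_segment[OF lim_1_over_n[where 'a = real], of 2] by simp
  define Y where "Y k = (\<chi> i. (1 - \<epsilon> k) * min (y $ i) (X k $ i) + \<epsilon> k * (X k $ i / 2))" for k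
  have "Y k \<in> \<Omega>" for k
  proof (rule monotone_toric_strict_descent[OF m X\<Omega>[of k]]; intro allI)
    fix i
    have lo: "0 \<le> min (y $ i) (X k $ i)" using y(1) Xpos[of k i] by (auto simp: orthant_def)
    show "0 < Y k $ i"
      unfolding Y_def using lo Xpos[of k i] \<epsilon>[of k] by (auto intro!: add_nonneg_pos mult_nonneg_nonneg)
    have "(1 - \<epsilon> k) * min (y $ i) (X k $ i) \<le> (1 - \<epsilon> k) * X k $ i"
      using \<epsilon>[of k] by (intro mult_left_mono) auto
    moreover have "\<epsilon> k * (X k $ i / 2) < \<epsilon> k * X k $ i" using \<epsilon>[of k] Xpos[of k i] by simp
    ultimately show "Y k $ i < X k $ i" by (simp add: Y_def algebra_simps)
  qed
  moreover have "Y \<longlonglongrightarrow> y"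
  proof (rule vec_tendstoI)
    fix i
    have "(\<lambda>k. Y k $ i) \<longlonglongrightarrow> (1 - 0) * min (y $ i) (x $ i) + 0 * (x $ i / 2)"
      unfolding Y_def vec_lambda_beta
      by (intro tendsto_intros \<epsilon>0 tendsto_vec_nth X(2)) auto
    then show "(\<lambda>k. Y k $ i) \<longlonglongrightarrow> y $ i" using y(2) by (simp add: min_absorb1)
  qed
  moreover have "closed \<Omega>" using V(2) by simp
  ultimately show ?thesis using closed_sequentially by blast
qed

lemma monotone_toric_compact:
  fixes \<Omega> :: "(real^'n) set"
  assumes "monotone_toric \<Omega>"
  shows "compact \<Omega>"
  using compact_continuous_image[OF continuous_on_moment_map, of "toric \<Omega>"]
    moment_map_image_toric[of \<Omega>] assms by (simp add: monotone_toric_def)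

lemma minimal_coordinate:
  fixes x :: "real^'n"
  obtains i where "\<And>j. x $ i \<le> x $ j"
proof -
  have "Min (range (\<lambda>j. x $ j)) \<in> range (\<lambda>j. x $ j)" by (intro Min_in) auto
  then obtain i where "x $ i = Min (range (\<lambda>j. x $ j))" by (metis rangeE)
  then have "x $ i \<le> x $ j" for j by simp
  then show thesis using that by blast
qed

text \<open>The diagonal parameter \<open>a\<close> is the largest \<open>t\<close> with \<open>(t, \<dots>, t) \<in> \<Omega>\<close>.\<close>

lemma monotone_toric_between_cube_and_cyl_union:
  fixes \<Omega> :: "(real^'n) set"
  assumes m: "monotone_toric \<Omega>"
  obtains a where "0 < a" "cube a \<subseteq> toric \<Omega>" "toric \<Omega> \<subseteq> cyl_union a"
proof -
  let ?diag = "\<lambda>t. (\<chi> i. t) :: real^'n"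
  have \<Omega>o: "\<Omega> \<subseteq> orthant" using m by (simp add: monotone_toric_def)
  define B where "B = {t. ?diag t \<in> \<Omega>}"
  have diag_min: "x $ i \<in> B" if "x \<in> \<Omega>" "\<And>j. x $ i \<le> x $ j" for x i
    unfolding B_def
    using monotone_toric_downward_closed[OF m that(1), of "?diag (x $ i)"] that \<Omega>o
    by (auto simp: orthant_def)
  obtain V where V: "open V" "V \<noteq> {}" "\<Omega> = closure V"
    using m by (auto simp: monotone_toric_def is_domain_def)
  have "compact B"
  proof -
    have "continuous_on UNIV ?diag" by (simp add: continuous_on_vec_lambda)
    then have "closed (?diag -` \<Omega>)" using V(3) by (intro closed_vimage) auto
    then have "closed B" by (simp add: B_def vimage_def)
    \<comment> \<open>Here \<open>undefined\<close> just picks some coordinate; all coordinates of a diagonal point agree.\<close>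
    moreover have "compact ((\<lambda>x. x $ undefined) ` \<Omega>)"
      using monotone_toric_compact[OF m] by (intro compact_continuous_image continuous_intros)
    moreover have "B \<subseteq> (\<lambda>x. x $ undefined) ` \<Omega>"
    proof
      fix t assume "t \<in> B"
      then show "t \<in> (\<lambda>x. x $ undefined) ` \<Omega>"
        by (intro image_eqI[of _ _ "?diag t"]) (simp_all add: B_def)
    qed
    ultimately have "closed B" "bounded B" using compact_imp_bounded bounded_subset by blast+
    then show ?thesis by (simp add: compact_eq_bounded_closed)
  qed
  moreover obtain x0 where x0: "x0 \<in> \<Omega>" "\<forall>i. 0 < x0 $ i"
  proof -
    obtain v where v: "v \<in> V" using V(2) by blast
    have "V \<subseteq> \<Omega>" using V(3) closure_subset by blast
    then show thesis using that v open_subset_orthant_positive[OF V(1)] \<Omega>o by blast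
  qed
  obtain i0 where i0: "\<And>j. x0 $ i0 \<le> x0 $ j" using minimal_coordinate by blast
  have "x0 $ i0 \<in> B" using diag_min x0 i0 by blast
  ultimately obtain a where a: "a \<in> B" "\<forall>t\<in>B. t \<le> a"
    using compact_attains_sup[of B] by blast
  show thesis
  proof
    show "0 < a" using a(2) \<open>x0 $ i0 \<in> B\<close> x0(2) less_le_trans by blast
    have "x \<in> \<Omega>" if "x \<in> orthant" "\<forall>i. x $ i \<le> a" for x
      using monotone_toric_downward_closed[OF m, of "?diag a" x] that a(1) by (simp add: B_def)
    then show "cube a \<subseteq> toric \<Omega>" by (auto simp: cube_def toric_def)
    have "\<exists>i. x $ i \<le> a" if "x \<in> \<Omega>" for x
      using minimal_coordinate[of x] diag_min[OF that] a(2) by metis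
    then show "toric \<Omega> \<subseteq> cyl_union a" using \<Omega>o by (auto simp: cyl_union_def toric_def)
  qed
qed


section \<open>Dilations as symplectic embeddings\<close>

lemma moment_map_scaleR: "moment_map (s *\<^sub>R z) = s\<^sup>2 *\<^sub>R moment_map z"
  by (simp add: moment_map_def vec_eq_iff power_mult_distrib)

lemma \<omega>\<^sub>0_scaleR: "\<omega>\<^sub>0 z (s *\<^sub>R u) (s *\<^sub>R v) = s\<^sup>2 * \<omega>\<^sub>0 z' u v"
  by (simp add: \<omega>\<^sub>0_def sum_distrib_left algebra_simps power2_eq_square)

lemma symplectic_embedding_scaleR:
  fixes X Y :: "(complex^'n) set"
  assumes s: "0 < s" and sub: "(\<lambda>z. s *\<^sub>R z) ` X \<subseteq> Y"
    and form: "\<And>x y u v. \<omega>' y (s *\<^sub>R u) (s *\<^sub>R v) = \<omega> x u v"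
  shows "symplectic_embedding (\<lambda>z. s *\<^sub>R z) (X, \<omega>) (Y, \<omega>')"
proof -
  let ?\<phi> = "\<lambda>z::complex^'n. s *\<^sub>R z"
  have D: "frechet_derivative ?\<phi> (at x) = ?\<phi>" for x
    by (intro frechet_derivative_eq bounded_linear_imp_has_derivative bounded_linear_scaleR_right)
  have "smooth_near X ?\<phi>"
    unfolding smooth_near_def smooth_on_def
    by (intro exI[of _ UNIV]) (simp add: Ck_on_bounded_linear bounded_linear_scaleR_right)
  moreover have "homeomorphism X (?\<phi> ` X) ?\<phi> (\<lambda>z. (1 / s) *\<^sub>R z)"
    using s by (intro homeomorphismI) (auto intro!: continuous_intros)
  moreover have "inj ?\<phi>" using s by (simp add: inj_on_def)
  ultimately show ?thesis
    using sub form
    by (auto simp: symplectic_embedding_def smooth_embedding_def pullback_def D fun_eq_iff)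
qed

text \<open>
  With the form \<open>a \<omega>\<^sub>0\<close> the unit models \<open>cube 1\<close> and \<open>cyl_union 1\<close> both have capacity \<open>a\<close> by
  conformality. The dilation by \<open>sqrt a\<close> embeds the first into \<open>toric \<Omega>\<close>, and its inverse embeds
  \<open>toric \<Omega>\<close> into the second.
\<close>

lemma capacity_of_squeezed_domain:
  fixes K :: "((complex^'n) set \<times> (complex^'n) two_form) set" and \<Omega> :: "(real^'n) set"
  assumes c: "symplectic_capacity K c" and norm: "cube_normalized c"
    and m: "monotone_toric \<Omega>" and a: "0 < a" "cube a \<subseteq> toric \<Omega>" "toric \<Omega> \<subseteq> cyl_union a"
  shows "c (toric \<Omega>, \<omega>\<^sub>0) = ennreal a"
proof -
  have mono: "c M \<le> c N" if "M \<in> K" "N \<in> K" "symplectic_embedding \<phi> M N" for M N \<phi>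
    using c that unfolding symplectic_capacity_def by blast
  have K: "(toric \<Omega>, \<omega>\<^sub>0) \<in> K" "(cube 1, \<omega>\<^sub>0) \<in> K" "(cyl_union 1, \<omega>\<^sub>0) \<in> K"
    using c m by (auto simp: symplectic_capacity_def admissible_class_def)
  then have Ka: "(cube 1, scale_form a \<omega>\<^sub>0) \<in> K" "(cyl_union 1, scale_form a \<omega>\<^sub>0) \<in> K"
    using c a(1) by (auto simp: symplectic_capacity_def admissible_class_def)
  have "c (X, scale_form a \<omega>\<^sub>0) = ennreal a * c (X, \<omega>\<^sub>0)" if "(X, \<omega>\<^sub>0) \<in> K" for X
    using c that a(1) by (simp add: symplectic_capacity_def)
  then have unit: "c (cube 1, scale_form a \<omega>\<^sub>0) = ennreal a"
    "c (cyl_union 1, scale_form a \<omega>\<^sub>0) = ennreal a"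
    using K norm by (simp_all add: cube_normalized_def)
  have "symplectic_embedding (\<lambda>z. sqrt a *\<^sub>R z) (cube 1, scale_form a \<omega>\<^sub>0) (toric \<Omega>, \<omega>\<^sub>0)"
  proof (rule symplectic_embedding_scaleR)
    have "sqrt a *\<^sub>R z \<in> cube a" if "z \<in> cube 1" for z
      using that a(1) mult_left_mono[of "moment_map z $ _" 1 a]
      by (auto simp: cube_def toric_def moment_map_scaleR orthant_def)
    then show "(\<lambda>z. sqrt a *\<^sub>R z) ` cube 1 \<subseteq> toric \<Omega>" using a(2) by blast
    show "\<omega>\<^sub>0 y (sqrt a *\<^sub>R u) (sqrt a *\<^sub>R v) = scale_form a \<omega>\<^sub>0 x u v" for x y u v :: "complex^'n"
      using \<omega>\<^sub>0_scaleR[of y "sqrt a" u v x] a(1) by (simp add: scale_form_def)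
  qed (use a in simp)
  then have "ennreal a \<le> c (toric \<Omega>, \<omega>\<^sub>0)" using mono Ka K unit by metis
  moreover
  have "symplectic_embedding (\<lambda>z. sqrt (1 / a) *\<^sub>R z) (toric \<Omega>, \<omega>\<^sub>0) (cyl_union 1, scale_form a \<omega>\<^sub>0)"
  proof (rule symplectic_embedding_scaleR)
    have "sqrt (1 / a) *\<^sub>R z \<in> cyl_union 1" if "z \<in> cyl_union a" for z
    proof -
      have "moment_map z \<in> orthant" "\<exists>i. moment_map z $ i \<le> a"
        using that by (auto simp: cyl_union_def toric_def)
      then obtain i where "moment_map z $ i \<le> a" "\<forall>j. 0 \<le> moment_map z $ j"
        unfolding orthant_def by blast
      then show ?thesis
        using a(1) by (auto simp: cyl_union_def toric_def moment_map_scaleR orthant_def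
            divide_le_eq_1 intro!: exI[of _ i])
    qed
    then show "(\<lambda>z. sqrt (1 / a) *\<^sub>R z) ` toric \<Omega> \<subseteq> cyl_union 1" using a(3) by blast
    show "scale_form a \<omega>\<^sub>0 y (sqrt (1 / a) *\<^sub>R u) (sqrt (1 / a) *\<^sub>R v) = \<omega>\<^sub>0 x u v"
      for x y u v :: "complex^'n"
      using \<omega>\<^sub>0_scaleR[of y "sqrt (1 / a)" u v x] a(1) by (simp add: scale_form_def)
  qed (use a in simp)
  then have "c (toric \<Omega>, \<omega>\<^sub>0) \<le> ennreal a" using mono Ka K unit by metis
  ultimately show ?thesis by (rule antisym[rotated])
qed

theorem theorem2:
  fixes K K' :: "((complex^'n) set \<times> (complex^'n) two_form) set"
    and c c' :: "(complex^'n) set \<times> (complex^'n) two_form \<Rightarrow> ennreal"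
    and \<Omega> :: "(real^'n) set"
  assumes "symplectic_capacity K c" and "cube_normalized c"
    and "symplectic_capacity K' c'" and "cube_normalized c'"
    and "monotone_toric \<Omega>"
  shows "c (toric \<Omega>, \<omega>\<^sub>0) = c' (toric \<Omega>, \<omega>\<^sub>0)"
proof -
  obtain a where "0 < a" "cube a \<subseteq> toric \<Omega>" "toric \<Omega> \<subseteq> cyl_union a"
    using monotone_toric_between_cube_and_cyl_union[OF assms(5)] .
  then show ?thesis
    using capacity_of_squeezed_domain assms by metis
qed

end
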